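(* Let $\mathcal{H}$ be an $\mathbb{R}^m$-RKHS over $\Omega$ with reproducing kernel $k$, let $\mathcal{N} \subset \mathcal{H}$ be a closed subspace with reproducing kernel $k_{\mathcal{N}}$, and let $\Pi_{\mathcal{N}} : \mathcal{H} \to \mathcal{N}$ be the orthogonal projection onto $\mathcal{N}$. Then for all $f \in \mathcal{H}$, $\alpha \in \mathbb{R}^m$ and $x \in \Omega$, $$\left|\left( f(x) - (\Pi_{\mathcal{N}}f)(x)\right)^T\alpha\right| \leq \mathcal{P}_{\mathcal{N}}^{\alpha}(x)\, \|f - \Pi_{\mathcal{N}}f\|_{\mathcal{H}} \leq \mathcal{P}_{\mathcal{N}}^{\alpha}(x)\, \|f\|_{\mathcal{H}},$$ and $$\| f(x) - (\Pi_{\mathcal{N}}f)(x)\|_2 \leq \| k(x,x)-k_{\mathcal{N}}(x,x) \|_2^{1/2}\, \|f - \Pi_{\mathcal{N}}f\|_{\mathcal{H}},$$ $$\| f(x) - (\Pi_{\mathcal{N}}f)(x)\|_{\infty} \leq \max_{i=1,\dots,m} |k(x,x)_{ii}-k_{\mathcal{N}}(x,x)_{ii}|^{1/2}\, \|f - \Pi_{\mathcal{N}}f\|_{\mathcal{H}},$$ $$\| f(x) - (\Pi_{\mathcal{N}}f)(x)\|_1 \leq \sqrt{m}\, \| k(x,x)-k_{\mathcal{N}}(x,x) \|_2^{1/2}\, \|f - \Pi_{\mathcal{N}}f\|_{\mathcal{H}}.$$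
   Context: $\Omega$ is a nonempty set and $m \in \mathbb{N}$. An $\mathbb{R}^m$-RKHS over $\Omega$ is a real Hilbert space $\mathcal{H}$ of functions $\Omega \to \mathbb{R}^m$ (with pointwise operations) such that for all $x \in \Omega$, $\alpha \in \mathbb{R}^m$ the functional $\delta_x^{\alpha} : \mathcal{H} \to \mathbb{R}$, $\delta_x^{\alpha}(f) := f(x)^T\alpha$, is bounded. Its reproducing kernel is the unique function $k : \Omega \times \Omega \to \mathbb{R}^{m\times m}$ such that $k(\cdot,x)\alpha \in \mathcal{H}$ and $\langle f, k(\cdot,x)\alpha\rangle_{\mathcal{H}} = f(x)^T\alpha$ for all $x\in\Omega$, $\alpha \in \mathbb{R}^m$, $f \in \mathcal{H}$. A closed subspace $\mathcal{N}\subset\mathcal{H}$, with the inner product of $\mathcal{H}$, is again an $\mathbb{R}^m$-RKHS, and $k_{\mathcal{N}}$ denotes its reproducing kernel. The power-function of $\mathcal{N}$ is $\mathcal{P}_{\mathcal{N}} : \mathcal{H}' \to \mathbb{R}$, $\mathcal{P}_{\mathcal{N}}(\lambda) := \sup_{f \in \mathcal{H}\setminus\{0\}} \frac{|\lambda(f) - \lambda(\Pi_{\mathcal{N}}(f))|}{\|f\|_{\mathcal{H}}}$, and $\mathcal{P}_{\mathcal{N}}^{\alpha}(x) := \mathcal{P}_{\mathcal{N}}(\delta_x^{\alpha})$. On $\mathbb{R}^m$, $\|\cdot\|_1, \|\cdot\|_2, \|\cdot\|_\infty$ are the usual vector norms; on $\mathbb{R}^{m\times m}$, $\|\cdot\|_2$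 is the spectral norm. *)

theory Defs
  imports "HOL-Analysis.Analysis"
begin

text \<open>
  A Hilbert space of functions from \<open>'a\<close> to \<open>real ^ 'm\<close> is given by a type \<open>'h\<close> in the classes
  \<open>real_inner\<close> and \<open>complete_space\<close>, whose elements are regarded as functions through the
  evaluation map \<open>ev\<close>. Injectivity says that an element is determined by its values, and
  linearity that the vector space operations are the pointwise ones.
\<close>

locale rkhs =
  fixes ev :: "'h::{real_inner,complete_space} \<Rightarrow> 'a \<Rightarrow> real ^ 'm"
  assumes inj_ev: "inj ev"
    and ev_add: "\<And>f g x. ev (f + g) x = ev f x + ev g x"
    and ev_scaleR: "\<And>c f x. ev (c *\<^sub>R f) x = c *\<^sub>R ev f x"
    and bounded_point_evaluation: "\<And>x \<alpha>. \<exists>C. \<forall>f. \<bar>ev f x \<bullet> \<alpha>\<bar> \<le> C * norm f"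

definition point_functional ::
    "('h::{real_inner,complete_space} \<Rightarrow> 'a \<Rightarrow> real ^ 'm) \<Rightarrow> 'a \<Rightarrow> real ^ 'm \<Rightarrow> 'h \<Rightarrow>\<^sub>L real"
  where "point_functional ev x \<alpha> = Blinfun (\<lambda>f. ev f x \<bullet> \<alpha>)"

text \<open>The kernel of a closed subspace \<open>N\<close>; the kernel of the whole space is the case \<open>N = UNIV\<close>.\<close>

definition is_reproducing_kernel ::
    "('h::{real_inner,complete_space} \<Rightarrow> 'a \<Rightarrow> real ^ 'm) \<Rightarrow> 'h set \<Rightarrow>
      ('a \<Rightarrow> 'a \<Rightarrow> real ^ 'm ^ 'm) \<Rightarrow> bool"
  where "is_reproducing_kernel ev N k \<longleftrightarrow>
    (\<forall>x \<alpha>. \<exists>g\<in>N. ev g = (\<lambda>y. k y x *v \<alpha>) \<and> (\<forall>f\<in>N. f \<bullet> g = ev f x \<bullet> \<alpha>))"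

definition reproducing_kernel ::
    "('h::{real_inner,complete_space} \<Rightarrow> 'a \<Rightarrow> real ^ 'm) \<Rightarrow> 'h set \<Rightarrow>
      'a \<Rightarrow> 'a \<Rightarrow> real ^ 'm ^ 'm"
  where "reproducing_kernel ev N = (THE k. is_reproducing_kernel ev N k)"

definition orth_proj :: "'h::{real_inner,complete_space} set \<Rightarrow> 'h \<Rightarrow> 'h"
  where "orth_proj N f = (THE g. g \<in> N \<and> (\<forall>h\<in>N. orthogonal (f - g) h))"

text \<open>
  All quotients are nonnegative, so inserting \<open>0\<close> only fixes the supremum of the empty family,
  which occurs for the zero space.
\<close>

definition power_function :: "'h::{real_inner,complete_space} set \<Rightarrow> ('h \<Rightarrow>\<^sub>L real) \<Rightarrow> real"
  where "power_function N l =
    Sup (insert 0 {\<bar>blinfun_apply l f - blinfun_apply l (orth_proj N f)\<bar> / norm f | f. f \<noteq> 0})"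

definition pointwise_power_function ::
    "('h::{real_inner,complete_space} \<Rightarrow> 'a \<Rightarrow> real ^ 'm) \<Rightarrow> 'h set \<Rightarrow> real ^ 'm \<Rightarrow> 'a \<Rightarrow> real"
  where "pointwise_power_function ev N \<alpha> x = power_function N (point_functional ev x \<alpha>)"

definition norm1 :: "real ^ 'm \<Rightarrow> real"
  where "norm1 v = (\<Sum>i\<in>UNIV. \<bar>v $ i\<bar>)"

definition spectral_norm :: "real ^ 'm ^ 'm \<Rightarrow> real"
  where "spectral_norm A = onorm ((*v) A)"

end

theory Submission
  imports Defs
begin

text \<open>
  Write \<open>e = f - P f\<close> for the residual of the orthogonal projection \<open>P\<close> onto \<open>N\<close>. Everything
  follows from \<open>e\<close> being orthogonal to \<open>N\<close>.

  For a functional \<open>l\<close>, orthogonality gives \<open>P e = 0\<close>, so \<open>l e = l e - l (P e)\<close>: up to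
  sign, \<open>l e\<close> is the numerator of the quotient that the power function takes at \<open>e\<close>
  (\<open>power_function_bound\<close>). Moreover, \<open>norm e \<le> norm f\<close> by
  Pythagoras.

  For the kernel bounds, let \<open>r\<close> be the Riesz representer of \<open>g \<mapsto> ev g x \<bullet> \<alpha>\<close>. The kernel of the
  whole space encodes \<open>r\<close>, and the kernel of \<open>N\<close> encodes \<open>P r\<close> (\<open>reproducing_kernel_mult\<close>). Since
  \<open>e\<close> is orthogonal to \<open>P r\<close>, one has \<open>ev e x \<bullet> \<alpha> = e \<bullet> (r - P r)\<close>, while
  \<open>(norm (r - P r))\<^sup>2 = (r - P r) \<bullet> r\<close> is the quadratic form of \<open>k x x - kN x x\<close> at \<open>\<alpha>\<close>.
  The Cauchy--Schwarz inequality in the Hilbert space then bounds \<open>ev e x \<bullet> \<alpha>\<close> by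
  the root of this form times \<open>norm e\<close> (\<open>residual_quadratic_form_bound\<close>). Choosing
  \<open>\<alpha> = ev e x\<close> gives the Euclidean estimate, the unit vectors give the estimate for the maximum
  norm, and comparing norms on \<open>real ^ 'm\<close> gives the one for the sum norm.

  Both the projection and the Riesz representers come from nearest points in closed convex sets,
  which exist by completeness and the parallelogram law.
\<close>

section \<open>Orthogonal projection in Hilbert spaces\<close>

text \<open>
  Points of \<open>S\<close> whose distance to \<open>a\<close> is nearly minimal are close to each other: by the
  parallelogram law, their midpoint, which lies in \<open>S\<close>, would otherwise be too close to \<open>a\<close>. Hence
  the sets of nearly minimal points shrink to a point by completeness.
\<close>

lemma nearest_point_exists:
  fixes S :: "'h::{real_inner,complete_space} set"
  assumes "convex S" "closed S" "S \<noteq> {}"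
  obtains p where "p \<in> S" "\<And>y. y \<in> S \<Longrightarrow> dist a p \<le> dist a y"
proof -
  define d where "d = infdist a S"
  \<comment> \<open>The slack is added to the squared distance, since that is what the parallelogram law bounds.\<close>
  define T where "T n = S \<inter> cball a (sqrt (d\<^sup>2 + 1 / Suc n))" for n :: nat
  have d_nonneg: "0 \<le> d"
    by (simp add: d_def infdist_nonneg)
  have d_le: "d \<le> dist a y" if "y \<in> S" for y
    using that by (simp add: d_def infdist_le)
  have T_sq: "(dist a y)\<^sup>2 \<le> d\<^sup>2 + 1 / Suc n" if "y \<in> T n" for y n
  proof -
    have "dist a y \<le> sqrt (d\<^sup>2 + 1 / Suc n)"
      using that by (simp add: T_def)
    then have "(dist a y)\<^sup>2 \<le> (sqrt (d\<^sup>2 + 1 / Suc n))\<^sup>2"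
      by (intro power_mono) auto
    then show ?thesis
      by simp
  qed
  have T_diam: "(dist y z)\<^sup>2 \<le> 4 / Suc n" if "y \<in> T n" "z \<in> T n" for y z n
  proof -
    let ?m = "(1/2) *\<^sub>R y + (1/2) *\<^sub>R z"
    have "?m \<in> S"
      using that \<open>convex S\<close> by (intro convexD) (auto simp: T_def)
    then have "d\<^sup>2 \<le> (dist a ?m)\<^sup>2"
      using d_le d_nonneg by (intro power_mono) auto
    moreover have "(dist y z)\<^sup>2 = 2 * (dist a y)\<^sup>2 + 2 * (dist a z)\<^sup>2 - 4 * (dist a ?m)\<^sup>2"
      by (simp add: dist_norm power2_norm_eq_inner inner_simps inner_commute field_simps)
    ultimately show ?thesis
      using T_sq[OF that(1)] T_sq[OF that(2)] by simp
  qed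
  obtain p where p: "\<And>n. p \<in> T n"
  proof (rule decreasing_closed_nest[of T])
    show "closed (T n)" for n
      using \<open>closed S\<close> by (auto simp: T_def)
    show "T n \<noteq> {}" for n
    proof -
      have "d < sqrt (d\<^sup>2 + 1 / Suc n)"
        by (intro real_less_rsqrt) simp
      then obtain y where "y \<in> S" "dist a y < sqrt (d\<^sup>2 + 1 / Suc n)"
        using \<open>S \<noteq> {}\<close> cInf_lessD[of "dist a ` S"] by (auto simp: d_def infdist_def)
      then show ?thesis
        by (auto simp: T_def intro: less_imp_le)
    qed
    show "T n \<subseteq> T m" if "m \<le> n" for m n
    proof -
      have "1 / real (Suc n) \<le> 1 / real (Suc m)"
        using that by (simp add: frac_le)
      then show ?thesis
        unfolding T_def by (intro Int_mono subset_cball real_sqrt_le_mono) auto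
    qed
    show "\<exists>n. \<forall>y\<in>T n. \<forall>z\<in>T n. dist y z < \<epsilon>" if "\<epsilon> > 0" for \<epsilon>
    proof -
      have "0 < \<epsilon>\<^sup>2 / 4"
        using that by simp
      then obtain n where n: "inverse (real (Suc n)) < \<epsilon>\<^sup>2 / 4"
        using reals_Archimedean[of "\<epsilon>\<^sup>2 / 4"] by blast
      have "dist y z < \<epsilon>" if "y \<in> T n" "z \<in> T n" for y z
      proof (rule power_less_imp_less_base)
        show "(dist y z)\<^sup>2 < \<epsilon>\<^sup>2"
          using T_diam[OF that] n divide_inverse[of 4 "real (Suc n)"] by linarith
      qed (use \<open>\<epsilon> > 0\<close> in simp)
      then show ?thesis
        by blast
    qed
  qed (rule that)
  show thesis
  proof
    show "p \<in> S"
      using p[of 0] by (simp add: T_def)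
    have "(dist a p)\<^sup>2 \<le> d\<^sup>2"
    proof (rule field_le_epsilon)
      fix \<epsilon> :: real assume "\<epsilon> > 0"
      then obtain n where "inverse (real (Suc n)) < \<epsilon>"
        using reals_Archimedean[of \<epsilon>] by blast
      then show "(dist a p)\<^sup>2 \<le> d\<^sup>2 + \<epsilon>"
        using T_sq[OF p, of n] inverse_eq_divide[of "real (Suc n)"] by linarith
    qed
    then have "dist a p \<le> d"
      using d_nonneg by (rule power2_le_imp_le)
    then show "dist a p \<le> dist a y" if "y \<in> S" for y
      using d_le[OF that] by simp
  qed
qed

lemma orth_proj_eqI:
  assumes "subspace N" "g \<in> N" "\<And>h. h \<in> N \<Longrightarrow> orthogonal (f - g) h"
  shows "orth_proj N f = g"
  unfolding orth_proj_def
proof (rule the_equality)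
  fix g' assume g': "g' \<in> N \<and> (\<forall>h\<in>N. orthogonal (f - g') h)"
  then have "g' - g \<in> N"
    using assms by (simp add: subspace_diff)
  then have "orthogonal (f - g) (g' - g)" "orthogonal (f - g') (g' - g)"
    using assms(3) g' by auto
  then have "(g' - g) \<bullet> (g' - g) = 0"
    by (simp add: orthogonal_def inner_diff_left inner_diff_right)
  then show "g' = g"
    by simp
qed (use assms in blast)

text \<open>
  The residual of the nearest point of \<open>N\<close> to \<open>f\<close> has a nonpositive inner product with every
  direction \<open>h\<close> of \<open>N\<close>; applied to \<open>h\<close> and \<open>- h\<close>, this is orthogonality.
\<close>

lemma
  assumes "subspace N" "closed N"
  shows orth_proj_in: "orth_proj N f \<in> N"
    and orth_proj_residual: "h \<in> N \<Longrightarrow> orthogonal (f - orth_proj N f) h"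
proof -
  obtain p where p: "p \<in> N" "\<And>y. y \<in> N \<Longrightarrow> dist f p \<le> dist f y"
    using nearest_point_exists[of N f] assms subspace_imp_convex subspace_0 by blast
  have nonpos: "(f - p) \<bullet> h \<le> 0" if "h \<in> N" for h
    using any_closest_point_dot[of N p "p + h" f] assms p that
    by (simp add: subspace_imp_convex subspace_add)
  have perp: "orthogonal (f - p) h" if "h \<in> N" for h
    using nonpos[OF that] nonpos[of "- h"] that assms(1)
    by (simp add: orthogonal_def subspace_neg)
  have "orth_proj N f = p"
    using assms(1) p(1) perp by (rule orth_proj_eqI)
  then show "orth_proj N f \<in> N" "h \<in> N \<Longrightarrow> orthogonal (f - orth_proj N f) h"
    using p perp by auto
qed

lemma orth_proj_UNIV [simp]: "orth_proj UNIV f = f"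
  by (rule orth_proj_eqI) (auto simp: orthogonal_def)

lemma orth_proj_residual_eq_0:
  assumes "subspace N" "closed N"
  shows "orth_proj N (f - orth_proj N f) = 0"
  using orth_proj_residual[OF assms] by (intro orth_proj_eqI) (auto simp: assms subspace_0)

lemma inner_orth_proj:
  assumes "subspace N" "closed N" "h \<in> N"
  shows "orth_proj N f \<bullet> h = f \<bullet> h"
  using orth_proj_residual[OF assms, of f] by (simp add: orthogonal_def inner_diff_left)

lemma linear_orth_proj:
  assumes "subspace N" "closed N"
  shows "linear (orth_proj N)"
proof
  note [simp] = assms orth_proj_in inner_orth_proj
  show "orth_proj N (f + g) = orth_proj N f + orth_proj N g" for f g
    by (rule orth_proj_eqI)
      (simp_all add: subspace_add orthogonal_def inner_diff_left inner_add_left)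
  show "orth_proj N (c *\<^sub>R f) = c *\<^sub>R orth_proj N f" for c f
    by (rule orth_proj_eqI) (simp_all add: subspace_scale orthogonal_def inner_diff_left)
qed

lemma norm_orth_proj_residual_le:
  assumes "subspace N" "closed N"
  shows "norm (f - orth_proj N f) \<le> norm f"
proof (rule power2_le_imp_le)
  have "orthogonal (f - orth_proj N f) (orth_proj N f)"
    using assms by (intro orth_proj_residual orth_proj_in)
  then show "(norm (f - orth_proj N f))\<^sup>2 \<le> (norm f)\<^sup>2"
    using norm_add_Pythagorean[of "f - orth_proj N f" "orth_proj N f"] by simp
qed simp

text \<open>
  For \<open>l\<close> not zero, the representer is, up to scaling, the residual \<open>z\<close> of projecting onto the null space of \<open>l\<close> some
  vector on which \<open>l\<close> does not vanish: every \<open>h\<close> differs from a multiple of \<open>z\<close> by an element of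
  the null space.
\<close>

lemma Riesz_representer_exists:
  fixes l :: "'h::{real_inner,complete_space} \<Rightarrow> real"
  assumes "bounded_linear l"
  shows "\<exists>g. \<forall>h. h \<bullet> g = l h"
proof (cases "\<forall>h. l h = 0")
  case True
  then show ?thesis
    by (intro exI[of _ 0]) simp
next
  case False
  interpret l: bounded_linear l by fact
  define K where "K = {h. l h = 0}"
  have K: "subspace K" "closed K"
  proof -
    show "subspace K"
      by (auto simp: K_def subspace_def l.zero l.add l.scale)
    show "closed K"
      unfolding K_def by (intro closed_Collect_eq l.continuous_on continuous_intros)
  qed
  obtain f where "l f \<noteq> 0"
    using False by blast
  define z where "z = f - orth_proj K f"
  have lz: "l z \<noteq> 0"
    using \<open>l f \<noteq> 0\<close> orth_proj_in[OF K, of f] by (simp add: z_def l.diff K_def)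
  then have "z \<noteq> 0"
    using l.zero by auto
  have "h \<bullet> ((l z / (z \<bullet> z)) *\<^sub>R z) = l h" for h
  proof -
    have "h - (l h / l z) *\<^sub>R z \<in> K"
      using lz by (simp add: K_def l.diff l.scale)
    then have "orthogonal z (h - (l h / l z) *\<^sub>R z)"
      unfolding z_def by (rule orth_proj_residual[OF K])
    then have "h \<bullet> z = (l h / l z) * (z \<bullet> z)"
      by (simp add: orthogonal_def inner_diff_right inner_commute)
    then show ?thesis
      using lz \<open>z \<noteq> 0\<close> by simp
  qed
  then show ?thesis
    by blast
qed

section \<open>The power function\<close>

text \<open>Boundedness of \<open>l\<close> is what makes the supremum in the power function a genuine one.\<close>

lemma power_function_bdd_above:
  assumes "subspace N" "closed N"
  shows "bdd_above (insert 0
    {\<bar>blinfun_apply l f - blinfun_apply l (orth_proj N f)\<bar> / norm f | f. f \<noteq> 0})"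
proof (rule bdd_aboveI[of _ "norm l"])
  fix q assume "q \<in> insert 0
    {\<bar>blinfun_apply l f - blinfun_apply l (orth_proj N f)\<bar> / norm f | f. f \<noteq> 0}"
  moreover have "\<bar>l f - l (orth_proj N f)\<bar> / norm f \<le> norm l" if "f \<noteq> 0" for f
  proof -
    have "\<bar>l f - l (orth_proj N f)\<bar> = norm (l (f - orth_proj N f))"
      by (simp add: blinfun.diff_right)
    also have "\<dots> \<le> norm l * norm (f - orth_proj N f)"
      by (rule norm_blinfun)
    also have "\<dots> \<le> norm l * norm f"
      by (intro mult_left_mono norm_orth_proj_residual_le assms) simp
    finally show ?thesis
      using that by (simp add: divide_le_eq)
  qed
  ultimately show "q \<le> norm l"
    by auto
qed

lemma power_function_nonneg:
  assumes "subspace N" "closed N"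
  shows "0 \<le> power_function N l"
  unfolding power_function_def by (rule cSup_upper[OF _ power_function_bdd_above[OF assms]]) simp

text \<open>
  The definition, tested on \<open>f\<close> itself, would only give \<open>norm f\<close> on the right. Testing it on the
  residual, whose projection vanishes, gives the sharper norm.
\<close>

lemma power_function_bound:
  assumes "subspace N" "closed N"
  shows "\<bar>blinfun_apply l (f - orth_proj N f)\<bar> \<le> power_function N l * norm (f - orth_proj N f)"
proof (cases "f - orth_proj N f = 0")
  case False
  let ?e = "f - orth_proj N f"
  have "\<bar>blinfun_apply l ?e - blinfun_apply l (orth_proj N ?e)\<bar> / norm ?e \<le> power_function N l"
    unfolding power_function_def
    by (rule cSup_upper[OF _ power_function_bdd_above[OF assms]]) (use False in blast)
  then show ?thesis
    using False by (simp add: orth_proj_residual_eq_0[OF assms] divide_le_eq)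
qed (simp add: blinfun.zero_right)

section \<open>Reproducing kernels of closed subspaces\<close>

context rkhs
begin

lemma ev_diff: "ev (f - g) x = ev f x - ev g x"
  using ev_add[of "f - g" g x] by simp

lemma bounded_linear_point_evaluation: "bounded_linear (\<lambda>f. ev f x \<bullet> \<alpha>)"
proof -
  obtain C where "\<And>f. \<bar>ev f x \<bullet> \<alpha>\<bar> \<le> C * norm f"
    using bounded_point_evaluation by blast
  then show ?thesis
    by (intro bounded_linear_intro[of _ C])
      (auto simp: ev_add ev_scaleR inner_add_left mult.commute)
qed

lemma point_functional_apply: "blinfun_apply (point_functional ev x \<alpha>) f = ev f x \<bullet> \<alpha>"
  by (simp add: point_functional_def bounded_linear_Blinfun_apply bounded_linear_point_evaluation)

definition representer :: "'a \<Rightarrow> real ^ 'm \<Rightarrow> 'h"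
  where "representer x \<alpha> = (SOME g. \<forall>f. f \<bullet> g = ev f x \<bullet> \<alpha>)"

lemma inner_representer: "f \<bullet> representer x \<alpha> = ev f x \<bullet> \<alpha>"
  using someI_ex[OF Riesz_representer_exists[OF bounded_linear_point_evaluation[of x \<alpha>]]]
  by (simp add: representer_def)

lemma linear_representer: "linear (representer x)"
proof
  show "representer x (\<alpha> + \<beta>) = representer x \<alpha> + representer x \<beta>" for \<alpha> \<beta>
    by (rule iffD1[OF vector_eq_ldot]) (simp add: inner_add_right inner_representer)
  show "representer x (c *\<^sub>R \<alpha>) = c *\<^sub>R representer x \<alpha>" for c \<alpha>
    by (rule iffD1[OF vector_eq_ldot]) (simp add: inner_representer)
qed

lemma linear_ev_orth_proj_representer:
  assumes "subspace N" "closed N"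
  shows "linear (\<lambda>\<alpha>. ev (orth_proj N (representer x \<alpha>)) y)"
proof -
  have "linear (\<lambda>f. ev f y)"
    by (rule linearI) (simp_all add: ev_add ev_scaleR)
  from linear_compose[OF linear_compose[OF linear_representer linear_orth_proj[OF assms]] this]
  show ?thesis
    by (simp add: o_def)
qed

text \<open>
  On \<open>N\<close>, the representer \<open>r\<close> and its projection have the same inner products, since their
  difference is orthogonal to \<open>N\<close>; so the projected representers are the ones of \<open>N\<close>.
\<close>

lemma is_reproducing_kernel_orth_proj_representer:
  assumes "subspace N" "closed N"
  shows "is_reproducing_kernel ev N (\<lambda>y x. matrix (\<lambda>\<alpha>. ev (orth_proj N (representer x \<alpha>)) y))"
  unfolding is_reproducing_kernel_def
proof (intro allI bexI conjI ballI)
  fix x \<alpha>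
  show "ev (orth_proj N (representer x \<alpha>)) =
    (\<lambda>y. matrix (\<lambda>\<alpha>. ev (orth_proj N (representer x \<alpha>)) y) *v \<alpha>)"
    by (simp add: matrix_works linear_ev_orth_proj_representer assms)
  show "orth_proj N (representer x \<alpha>) \<in> N"
    by (rule orth_proj_in[OF assms])
  fix f assume "f \<in> N"
  then have "f \<bullet> orth_proj N (representer x \<alpha>) = f \<bullet> representer x \<alpha>"
    using inner_orth_proj[OF assms] by (simp add: inner_commute)
  then show "f \<bullet> orth_proj N (representer x \<alpha>) = ev f x \<bullet> \<alpha>"
    by (simp add: inner_representer)
qed

text \<open>
  Two elements of \<open>N\<close> reproducing the same functional on \<open>N\<close> coincide, because their difference is
  in \<open>N\<close> and orthogonal to \<open>N\<close>; and a matrix is determined by its products with vectors.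
\<close>

lemma is_reproducing_kernel_unique:
  assumes "subspace N" "is_reproducing_kernel ev N k" "is_reproducing_kernel ev N k'"
  shows "k = k'"
proof (intro ext)
  fix y x
  have "k y x *v \<alpha> = k' y x *v \<alpha>" for \<alpha>
  proof -
    obtain g where g: "g \<in> N" "ev g = (\<lambda>y. k y x *v \<alpha>)" "\<And>f. f \<in> N \<Longrightarrow> f \<bullet> g = ev f x \<bullet> \<alpha>"
      using assms(2) unfolding is_reproducing_kernel_def by blast
    obtain g' where g': "g' \<in> N" "ev g' = (\<lambda>y. k' y x *v \<alpha>)" "\<And>f. f \<in> N \<Longrightarrow> f \<bullet> g' = ev f x \<bullet> \<alpha>"
      using assms(3) unfolding is_reproducing_kernel_def by blast
    have "g - g' \<in> N"
      using assms(1) g g' by (simp add: subspace_diff)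
    then have "(g - g') \<bullet> (g - g') = 0"
      using g(3) g'(3) by (simp add: inner_diff_right)
    then have "g = g'"
      by simp
    then show ?thesis
      using g(2) g'(2) by metis
  qed
  then show "k y x = k' y x"
    by (simp add: matrix_eq)
qed

lemma reproducing_kernel_mult:
  assumes "subspace N" "closed N"
  shows "reproducing_kernel ev N y x *v \<alpha> = ev (orth_proj N (representer x \<alpha>)) y"
proof -
  have "reproducing_kernel ev N = (\<lambda>y x. matrix (\<lambda>\<alpha>. ev (orth_proj N (representer x \<alpha>)) y))"
    unfolding reproducing_kernel_def
    using is_reproducing_kernel_orth_proj_representer[OF assms]
      is_reproducing_kernel_unique[OF assms(1)] by blast
  then show ?thesis
    by (simp add: matrix_works linear_ev_orth_proj_representer assms)
qed

text \<open>
  This is the Cauchy--Schwarz inequality for the residual of \<open>f\<close> and the residual \<open>s\<close> of the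
  representer: the square root is the norm of \<open>s\<close>.
\<close>

lemma residual_quadratic_form_bound:
  assumes "subspace N" "closed N"
  shows "\<bar>ev (f - orth_proj N f) x \<bullet> \<alpha>\<bar>
    \<le> sqrt (((reproducing_kernel ev UNIV x x - reproducing_kernel ev N x x) *v \<alpha>) \<bullet> \<alpha>)
      * norm (f - orth_proj N f)"
proof -
  let ?e = "f - orth_proj N f"
  define r where "r = representer x \<alpha>"
  define s where "s = r - orth_proj N r"
  have perp: "h \<bullet> orth_proj N r = 0" if "h = f' - orth_proj N f'" for h f'
    using that orth_proj_residual[OF assms orth_proj_in[OF assms]] by (simp add: orthogonal_def)
  have "ev ?e x \<bullet> \<alpha> = ?e \<bullet> r"
    by (simp add: r_def inner_representer)
  also have "\<dots> = ?e \<bullet> s"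
    using perp[OF refl, of f] by (simp add: s_def inner_diff_right)
  finally have e: "ev ?e x \<bullet> \<alpha> = ?e \<bullet> s" .
  have "(norm s)\<^sup>2 = s \<bullet> r"
    using perp[OF s_def] by (simp add: power2_norm_eq_inner s_def inner_diff_right)
  also have "\<dots> = ev s x \<bullet> \<alpha>"
    by (simp add: r_def inner_representer)
  also have "ev s x = (reproducing_kernel ev UNIV x x - reproducing_kernel ev N x x) *v \<alpha>"
    by (simp add: s_def r_def ev_diff matrix_vector_mult_diff_rdistrib
        reproducing_kernel_mult assms)
  finally have "norm s =
      sqrt (((reproducing_kernel ev UNIV x x - reproducing_kernel ev N x x) *v \<alpha>) \<bullet> \<alpha>)"
    by (metis norm_ge_zero real_sqrt_unique)
  then show ?thesis
    using Cauchy_Schwarz_ineq2[of ?e s] by (simp add: e mult.commute)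
qed

end

section \<open>Norms on Euclidean space\<close>

lemma quadratic_form_le_spectral_norm: "(A *v \<alpha>) \<bullet> \<alpha> \<le> spectral_norm A * (norm \<alpha>)\<^sup>2"
proof -
  have "(A *v \<alpha>) \<bullet> \<alpha> \<le> norm (A *v \<alpha>) * norm \<alpha>"
    by (rule norm_cauchy_schwarz)
  also have "\<dots> \<le> (spectral_norm A * norm \<alpha>) * norm \<alpha>"
    unfolding spectral_norm_def
    by (intro mult_right_mono onorm matrix_vector_mul_bounded_linear) simp
  finally show ?thesis
    by (simp add: power2_eq_square mult.assoc)
qed

lemma norm1_le_norm: "norm1 v \<le> sqrt (real CARD('m)) * norm v" for v :: "real ^ 'm"
proof -
  have "(norm1 v)\<^sup>2 \<le> (\<Sum>i\<in>UNIV. \<bar>v $ i\<bar>\<^sup>2) * real CARD('m)"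
    unfolding norm1_def by (rule sum_squared_le_sum_of_squares)
  also have "(\<Sum>i\<in>UNIV. \<bar>v $ i\<bar>\<^sup>2) = (norm v)\<^sup>2"
    by (simp add: norm_vec_def L2_set_def sum_nonneg)
  finally have "norm1 v \<le> sqrt ((norm v)\<^sup>2 * real CARD('m))"
    by (rule real_le_rsqrt)
  then show ?thesis
    by (simp add: real_sqrt_mult mult.commute)
qed

section \<open>Error bounds for the projection\<close>

theorem corollary2p11:
  fixes ev :: "'h::{real_inner,complete_space} \<Rightarrow> 'a \<Rightarrow> real ^ 'm"
    and N :: "'h set"
    and k kN :: "'a \<Rightarrow> 'a \<Rightarrow> real ^ 'm ^ 'm"
    and f :: 'h and \<alpha> :: "real ^ 'm" and x :: 'a
  assumes "rkhs ev"
    and "subspace N" and "closed N"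
    and "k = reproducing_kernel ev UNIV"
    and "kN = reproducing_kernel ev N"
  shows "\<bar>(ev f x - ev (orth_proj N f) x) \<bullet> \<alpha>\<bar>
            \<le> pointwise_power_function ev N \<alpha> x * norm (f - orth_proj N f)
       \<and> pointwise_power_function ev N \<alpha> x * norm (f - orth_proj N f)
            \<le> pointwise_power_function ev N \<alpha> x * norm f
       \<and> norm (ev f x - ev (orth_proj N f) x)
            \<le> sqrt (spectral_norm (k x x - kN x x)) * norm (f - orth_proj N f)
       \<and> infnorm (ev f x - ev (orth_proj N f) x)
            \<le> (MAX i\<in>UNIV. sqrt \<bar>k x x $ i $ i - kN x x $ i $ i\<bar>) * norm (f - orth_proj N f)
       \<and> norm1 (ev f x - ev (orth_proj N f) x)
            \<le> sqrt (real CARD('m)) * sqrt (spectral_norm (k x x - kN x x))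
              * norm (f - orth_proj N f)"
proof -
  interpret rkhs ev by fact
  note N = \<open>subspace N\<close> \<open>closed N\<close>
  let ?e = "f - orth_proj N f"
  let ?v = "ev f x - ev (orth_proj N f) x"
  let ?A = "k x x - kN x x"
  have v: "?v = ev ?e x"
    by (simp add: ev_diff)
  have quad: "\<bar>?v \<bullet> \<beta>\<bar> \<le> sqrt ((?A *v \<beta>) \<bullet> \<beta>) * norm ?e" for \<beta>
    using residual_quadratic_form_bound[OF N] by (simp add: v assms(4,5))
  have power: "\<bar>?v \<bullet> \<alpha>\<bar> \<le> pointwise_power_function ev N \<alpha> x * norm ?e"
    using power_function_bound[OF N, of "point_functional ev x \<alpha>" f]
    by (simp add: v point_functional_apply pointwise_power_function_def)
  have power_mono: "pointwise_power_function ev N \<alpha> x * norm ?e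
      \<le> pointwise_power_function ev N \<alpha> x * norm f"
    unfolding pointwise_power_function_def
    by (intro mult_left_mono norm_orth_proj_residual_le power_function_nonneg N)
  have spectral: "norm ?v \<le> sqrt (spectral_norm ?A) * norm ?e"
  proof (cases "?v = 0")
    case True
    have "0 \<le> spectral_norm ?A"
      by (simp add: spectral_norm_def onorm_pos_le matrix_vector_mul_bounded_linear)
    then show ?thesis
      using True by simp
  next
    case False
    \<comment> \<open>Testing the form on \<open>?v\<close> itself yields the bound with an extra factor \<open>norm ?v\<close>.\<close>
    have "norm ?v * norm ?v = \<bar>?v \<bullet> ?v\<bar>"
      by (simp add: power2_norm_eq_inner flip: power2_eq_square)
    also have "\<dots> \<le> sqrt ((?A *v ?v) \<bullet> ?v) * norm ?e"
      by (rule quad)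
    also have "\<dots> \<le> sqrt (spectral_norm ?A * (norm ?v)\<^sup>2) * norm ?e"
      by (intro mult_right_mono real_sqrt_le_mono quadratic_form_le_spectral_norm) simp
    also have "\<dots> = (sqrt (spectral_norm ?A) * norm ?e) * norm ?v"
      by (simp add: real_sqrt_mult)
    finally show ?thesis
      using False by (simp only: mult_le_cancel_right) simp
  qed
  have maximum: "infnorm ?v \<le> (MAX i\<in>UNIV. sqrt \<bar>?A $ i $ i\<bar>) * norm ?e"
  proof -
    have "\<bar>?v $ i\<bar> \<le> (MAX i\<in>UNIV. sqrt \<bar>?A $ i $ i\<bar>) * norm ?e" for i
    proof -
      have "\<bar>?v $ i\<bar> \<le> sqrt (?A $ i $ i) * norm ?e"
        using quad[of "axis i 1"]
        by (simp add: inner_axis matrix_vector_mult_basis column_def)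
      also have "\<dots> \<le> sqrt \<bar>?A $ i $ i\<bar> * norm ?e"
        by (intro mult_right_mono real_sqrt_le_mono) auto
      also have "\<dots> \<le> (MAX i\<in>UNIV. sqrt \<bar>?A $ i $ i\<bar>) * norm ?e"
        by (intro mult_right_mono Max_ge) auto
      finally show ?thesis .
    qed
    then show ?thesis
      unfolding infnorm_cart by (intro cSup_least) auto
  qed
  have sum: "norm1 ?v \<le> sqrt (real CARD('m)) * sqrt (spectral_norm ?A) * norm ?e"
    using order_trans[OF norm1_le_norm mult_left_mono[OF spectral]] by (simp add: mult.assoc)
  show ?thesis
    using power power_mono spectral maximum sum by simp
qed

end
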